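(* Let $A\in\mathbb{R}^{k\times r}$, $\mathbf{a}\in\mathbb{R}^r$, $\mathbf{b}\in\mathbb{R}^l$ and $B\in\mathbb{R}^{l\times s}$, and suppose $M=\begin{bmatrix}A\\ \mathbf{a}^T\end{bmatrix}$ and $N=\left[\begin{array}{c|c}\mathbf{b} & B\end{array}\right]$ are row orthogonal (i.e. $MM^T=I$ and $NN^T=I$), where $\mathbf{a}$ and $\mathbf{b}$ are nowhere zero. Then $$Q=\begin{bmatrix}A & O\\ \mathbf{b}\mathbf{a}^T & B\end{bmatrix}$$ is row orthogonal. Further, $Q$ has the strong inner product property if and only if both $M$ and $N$ have the strong inner product property.
   Context: All matrices are real; $\circ$ denotes the Hadamard product; a vector is nowhere zero if all of its entries are nonzero. A matrix $P\in\mathbb{R}^{p\times q}$ with $p\le q$ has the strong inner product property (SIPP) if $P$ has rank $p$ and $X=O$ is the only symmetric $p\times p$ matrix $X$ with $(XP)\circ P=O$. *)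

theory Defs
  imports "Jordan_Normal_Form.DL_Rank"
begin

definition append_cols :: "'a :: zero mat \<Rightarrow> 'a mat \<Rightarrow> 'a mat" (infixr \<open>@\<^sub>c\<close> 65) where
  "A @\<^sub>c B = four_block_mat A B (0\<^sub>m 0 (dim_col A)) (0\<^sub>m 0 (dim_col B))"

definition hadamard_mat :: "'a :: times mat \<Rightarrow> 'a mat \<Rightarrow> 'a mat" (infixl \<open>\<circ>\<^sub>m\<close> 70) where
  "A \<circ>\<^sub>m B = mat (dim_row A) (dim_col A) (\<lambda>ij. A $$ ij * B $$ ij)"

definition mat_of_col :: "'a vec \<Rightarrow> 'a mat" where
  "mat_of_col v = mat_of_cols (dim_vec v) [v]"

definition nowhere_zero :: "'a :: zero vec \<Rightarrow> bool" where
  "nowhere_zero v \<longleftrightarrow> (\<forall>i < dim_vec v. v $ i \<noteq> 0)"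

definition row_orthogonal :: "real mat \<Rightarrow> bool" where
  "row_orthogonal P \<longleftrightarrow> P * P\<^sup>T = 1\<^sub>m (dim_row P)"

definition SIPP :: "real mat \<Rightarrow> bool" where
  "SIPP P \<longleftrightarrow>
     dim_row P \<le> dim_col P \<and>
     vec_space.rank (dim_row P) P = dim_row P \<and>
     (\<forall>X \<in> carrier_mat (dim_row P) (dim_row P).
        X\<^sup>T = X \<and> (X * P) \<circ>\<^sub>m P = 0\<^sub>m (dim_row P) (dim_col P)
        \<longrightarrow> X = 0\<^sub>m (dim_row P) (dim_row P))"

end

theory Submission
  imports Defs
begin

text \<open>Call the symmetric \<open>X\<close> with \<open>(X P) \<circ> P = O\<close> the kernel of \<open>P\<close>. Write a symmetric \<open>X\<close> in blocks
  \<open>Y\<close>, \<open>Z\<close>, \<open>Z\<^sup>T\<close>, \<open>W\<close> and let \<open>P\<close> be block lower triangular with diagonal blocks \<open>A\<close>, \<open>B\<close> and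
  lower left block \<open>C\<close>. If \<open>C\<close> has no zero entry, the Hadamard condition on the lower left block is
  the full equation \<open>Z\<^sup>T A + W C = O\<close>. Row orthogonality of \<open>P\<close> gives \<open>A A\<^sup>T = I\<close> and \<open>C A\<^sup>T = O\<close>,
  so multiplying by \<open>A\<^sup>T\<close> forces \<open>Z = O\<close>: the kernel of \<open>P\<close> is the direct sum of those of \<open>A\<close>
  and of \<open>[C | B]\<close>. For \<open>C = L R\<close> with \<open>R\<close> right invertible, \<open>W C = O\<close> means \<open>W L = O\<close>, so
  \<open>[L R | B]\<close> and \<open>[L | B]\<close> have the same kernel, while adding the rows of \<open>R\<close> below \<open>A\<close> adds
  nothing to the kernel of \<open>A\<close>. The theorem is the case where \<open>L\<close> is a column and \<open>R\<close> a row.\<close>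

subsection \<open>Block matrices\<close>

lemma split_block_four_block_mat:
  assumes "A \<in> carrier_mat m p" "B \<in> carrier_mat m q" "C \<in> carrier_mat n p" "D \<in> carrier_mat n q"
  shows "split_block (four_block_mat A B C D) m p = (A, B, C, D)"
  using assms by (auto simp: split_block_def Let_def intro!: eq_matI)

lemma four_block_mat_eq_iff:
  assumes "A \<in> carrier_mat m p" "B \<in> carrier_mat m q" "C \<in> carrier_mat n p" "D \<in> carrier_mat n q"
    and "A' \<in> carrier_mat m p" "B' \<in> carrier_mat m q" "C' \<in> carrier_mat n p" "D' \<in> carrier_mat n q"
  shows "four_block_mat A B C D = four_block_mat A' B' C' D' \<longleftrightarrow>
    A = A' \<and> B = B' \<and> C = C' \<and> D = D'"
  using split_block_four_block_mat[OF assms(1-4)] split_block_four_block_mat[OF assms(5-8)]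
  by (metis prod.inject)

lemma four_block_mat_eq_zero_iff:
  assumes "A \<in> carrier_mat m p" "B \<in> carrier_mat m q" "C \<in> carrier_mat n p" "D \<in> carrier_mat n q"
  shows "four_block_mat A B C D = 0\<^sub>m (m + n) (p + q) \<longleftrightarrow>
    A = 0\<^sub>m m p \<and> B = 0\<^sub>m m q \<and> C = 0\<^sub>m n p \<and> D = 0\<^sub>m n q"
  unfolding four_block_zero_mat[symmetric]
  by (rule four_block_mat_eq_iff) (use assms in auto)

lemma symmetric_four_block_mat_iff:
  assumes "Y \<in> carrier_mat m m" "Z \<in> carrier_mat m n" "V \<in> carrier_mat n m" "W \<in> carrier_mat n n"
  shows "(four_block_mat Y Z V W)\<^sup>T = four_block_mat Y Z V W \<longleftrightarrow> Y\<^sup>T = Y \<and> V = Z\<^sup>T \<and> W\<^sup>T = W"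
proof -
  have "(four_block_mat Y Z V W)\<^sup>T = four_block_mat Y Z V W \<longleftrightarrow>
      Y\<^sup>T = Y \<and> V\<^sup>T = Z \<and> Z\<^sup>T = V \<and> W\<^sup>T = W"
    unfolding transpose_four_block_mat[OF assms]
    by (rule four_block_mat_eq_iff) (use assms in auto)
  then show ?thesis
    by (metis Matrix.transpose_transpose)
qed

lemma symmetric_mat_blocks:
  assumes X: "X \<in> carrier_mat (m + n) (m + n)" and sym: "X\<^sup>T = X"
  obtains Y Z W where "Y \<in> carrier_mat m m" "Z \<in> carrier_mat m n" "W \<in> carrier_mat n n"
    "X = four_block_mat Y Z Z\<^sup>T W"
proof -
  obtain Y Z V W where split: "split_block X m m = (Y, Z, V, W)"
    by (metis prod_cases4)
  have blocks: "Y \<in> carrier_mat m m" "Z \<in> carrier_mat m n" "V \<in> carrier_mat n m"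
      "W \<in> carrier_mat n n"
    and X_eq: "X = four_block_mat Y Z V W"
    using split_block[OF split, of n n] X by auto
  then have "V = Z\<^sup>T"
    using sym symmetric_four_block_mat_iff[OF blocks] by simp
  with that blocks X_eq show ?thesis
    by blast
qed

lemma append_cols_carrier [simp]:
  "C \<in> carrier_mat n p \<Longrightarrow> B \<in> carrier_mat n q \<Longrightarrow> C @\<^sub>c B \<in> carrier_mat n (p + q)"
  unfolding append_cols_def by auto

lemma append_cols_no_cols:
  assumes "C \<in> carrier_mat n p"
  shows "C @\<^sub>c 0\<^sub>m n 0 = C"
  by (rule eq_matI) (use assms in \<open>auto simp: append_cols_def\<close>)

lemma append_cols_eq_zero_iff:
  assumes "C \<in> carrier_mat n p" "B \<in> carrier_mat n q"
  shows "C @\<^sub>c B = 0\<^sub>m n (p + q) \<longleftrightarrow> C = 0\<^sub>m n p \<and> B = 0\<^sub>m n q"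
  using four_block_mat_eq_zero_iff[OF assms, of "0\<^sub>m 0 p" 0 "0\<^sub>m 0 q"] assms
  by (simp add: append_cols_def)

lemma mult_append_cols:
  assumes "W \<in> carrier_mat m n" "C \<in> carrier_mat n p" "B \<in> carrier_mat n q"
  shows "W * (C @\<^sub>c B) = W * C @\<^sub>c W * B"
  by (rule eq_matI) (use assms in \<open>auto simp: append_cols_def scalar_prod_def intro!: sum.cong\<close>)

lemma append_cols_mult_transpose:
  assumes "C \<in> carrier_mat n p" "B \<in> carrier_mat n q"
  shows "(C @\<^sub>c B) * (C @\<^sub>c B)\<^sup>T = C * C\<^sup>T + B * B\<^sup>T"
proof -
  have "(C @\<^sub>c B) * (C @\<^sub>c B)\<^sup>T =
      four_block_mat (C * C\<^sup>T + B * B\<^sup>T) (0\<^sub>m n 0) (0\<^sub>m 0 n) (0\<^sub>m 0 0)"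
    using assms
    by (simp add: append_cols_def transpose_four_block_mat[of _ n p _ q _ 0]
        mult_four_block_mat[of _ n p _ q _ 0 _ _ n _ 0])
  also have "\<dots> = C * C\<^sup>T + B * B\<^sup>T"
    by (rule eq_matI) (use assms in auto)
  finally show ?thesis .
qed

lemma append_rows_eq_four_block_mat:
  assumes "A \<in> carrier_mat k r" "R \<in> carrier_mat m r"
  shows "A @\<^sub>r R = four_block_mat A (0\<^sub>m k 0) R (0\<^sub>m m 0)"
  using assms by (simp add: append_rows_def)

lemma mult_eq_zero_iff_of_right_inverse:
  fixes W :: "'a :: semiring_1 mat"
  assumes W: "W \<in> carrier_mat n m" and R: "R \<in> carrier_mat m r" and S: "S \<in> carrier_mat r m"
    and RS: "R * S = 1\<^sub>m m"
  shows "W * R = 0\<^sub>m n r \<longleftrightarrow> W = 0\<^sub>m n m"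
proof
  assume "W * R = 0\<^sub>m n r"
  then have "W * R * S = 0\<^sub>m n m"
    using S by simp
  then show "W = 0\<^sub>m n m"
    using W R S RS by simp
qed (use R in simp)

lemma mult_add_mult_eq_zero_iff:
  fixes A :: "'a :: semiring_1 mat"
  assumes A: "A \<in> carrier_mat k r" and C: "C \<in> carrier_mat l r" and S: "S \<in> carrier_mat r k"
    and AS: "A * S = 1\<^sub>m k" and CS: "C * S = 0\<^sub>m l k"
    and V: "V \<in> carrier_mat n k" and W: "W \<in> carrier_mat n l"
  shows "V * A + W * C = 0\<^sub>m n r \<longleftrightarrow> V = 0\<^sub>m n k \<and> W * C = 0\<^sub>m n r"
proof
  assume sum_zero: "V * A + W * C = 0\<^sub>m n r"
  have "V = V * A * S + W * C * S"
    using A C S AS CS V W by simp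
  also have "\<dots> = (V * A + W * C) * S"
    by (rule add_mult_distrib_mat[symmetric]) (use A C S V W in auto)
  also have "\<dots> = 0\<^sub>m n k"
    using S by (simp add: sum_zero)
  finally have "V = 0\<^sub>m n k" .
  with sum_zero show "V = 0\<^sub>m n k \<and> W * C = 0\<^sub>m n r"
    using A C W by simp
qed (use A in simp)

subsection \<open>The Hadamard product\<close>

lemma hadamard_mat_carrier [simp]:
  "A \<in> carrier_mat m n \<Longrightarrow> A \<circ>\<^sub>m B \<in> carrier_mat m n"
  unfolding hadamard_mat_def by auto

lemma hadamard_four_block_mat:
  assumes "A \<in> carrier_mat m p" "B \<in> carrier_mat m q" "C \<in> carrier_mat n p" "D \<in> carrier_mat n q"
    and "A' \<in> carrier_mat m p" "B' \<in> carrier_mat m q" "C' \<in> carrier_mat n p" "D' \<in> carrier_mat n q"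
  shows "four_block_mat A B C D \<circ>\<^sub>m four_block_mat A' B' C' D' =
    four_block_mat (A \<circ>\<^sub>m A') (B \<circ>\<^sub>m B') (C \<circ>\<^sub>m C') (D \<circ>\<^sub>m D')"
  by (rule eq_matI) (use assms in \<open>auto simp: hadamard_mat_def\<close>)

lemma hadamard_append_cols:
  assumes "C \<in> carrier_mat n p" "B \<in> carrier_mat n q" "C' \<in> carrier_mat n p" "B' \<in> carrier_mat n q"
  shows "(C @\<^sub>c B) \<circ>\<^sub>m (C' @\<^sub>c B') = (C \<circ>\<^sub>m C') @\<^sub>c (B \<circ>\<^sub>m B')"
  by (rule eq_matI) (use assms in \<open>auto simp: append_cols_def hadamard_mat_def\<close>)

lemma hadamard_zero_right:
  fixes A :: "'a :: mult_zero mat"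
  assumes "A \<in> carrier_mat m n"
  shows "A \<circ>\<^sub>m 0\<^sub>m m n = 0\<^sub>m m n"
  by (rule eq_matI) (use assms in \<open>auto simp: hadamard_mat_def\<close>)

lemma hadamard_zero_left:
  fixes A :: "'a :: mult_zero mat"
  assumes "A \<in> carrier_mat m n"
  shows "0\<^sub>m m n \<circ>\<^sub>m A = 0\<^sub>m m n"
  by (rule eq_matI) (use assms in \<open>auto simp: hadamard_mat_def\<close>)

lemma hadamard_eq_zero_iff:
  fixes A C :: "'a :: semiring_no_zero_divisors mat"
  assumes A: "A \<in> carrier_mat m n" and C: "C \<in> carrier_mat m n" and nz: "0 \<notin> elements_mat C"
  shows "A \<circ>\<^sub>m C = 0\<^sub>m m n \<longleftrightarrow> A = 0\<^sub>m m n"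
proof
  assume zero: "A \<circ>\<^sub>m C = 0\<^sub>m m n"
  show "A = 0\<^sub>m m n"
  proof (rule eq_matI)
    fix i j assume ij: "i < dim_row (0\<^sub>m m n :: 'a mat)" "j < dim_col (0\<^sub>m m n :: 'a mat)"
    have "A $$ (i, j) * C $$ (i, j) = (A \<circ>\<^sub>m C) $$ (i, j)"
      using A ij by (simp add: hadamard_mat_def)
    moreover have "C $$ (i, j) \<noteq> 0"
      using C nz ij elements_matI[OF C, of i j 0] by auto
    ultimately show "A $$ (i, j) = 0\<^sub>m m n $$ (i, j)"
      using zero ij by simp
  qed (use A in auto)
qed (use C in \<open>simp add: hadamard_zero_left\<close>)

subsection \<open>The kernel of the strong inner product property\<close>

definition SIPP_kernel :: "'a :: semiring_0 mat \<Rightarrow> 'a mat set" where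
  "SIPP_kernel P = {X \<in> carrier_mat (dim_row P) (dim_row P).
     X\<^sup>T = X \<and> (X * P) \<circ>\<^sub>m P = 0\<^sub>m (dim_row P) (dim_col P)}"

lemma mem_SIPP_kernel_iff:
  assumes "P \<in> carrier_mat m n"
  shows "X \<in> SIPP_kernel P \<longleftrightarrow>
    X \<in> carrier_mat m m \<and> X\<^sup>T = X \<and> (X * P) \<circ>\<^sub>m P = 0\<^sub>m m n"
  using assms by (auto simp: SIPP_kernel_def)

lemma zero_mem_SIPP_kernel:
  assumes "P \<in> carrier_mat m n"
  shows "0\<^sub>m m m \<in> SIPP_kernel P"
  using assms by (simp add: mem_SIPP_kernel_iff hadamard_zero_left)

lemma SIPP_kernel_nowhere_zero:
  fixes P :: "'a :: semiring_no_zero_divisors mat"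
  assumes P: "P \<in> carrier_mat m n" and nz: "0 \<notin> elements_mat P"
  shows "SIPP_kernel P = {X \<in> carrier_mat m m. X\<^sup>T = X \<and> X * P = 0\<^sub>m m n}"
  using hadamard_eq_zero_iff[OF _ P nz] P by (auto simp: mem_SIPP_kernel_iff)

lemma SIPP_kernel_append_cols:
  fixes C :: "'a :: semiring_no_zero_divisors mat"
  assumes C: "C \<in> carrier_mat l r" and B: "B \<in> carrier_mat l s" and nz: "0 \<notin> elements_mat C"
  shows "SIPP_kernel (C @\<^sub>c B) = {W \<in> SIPP_kernel B. W * C = 0\<^sub>m l r}"
proof -
  have "(W * (C @\<^sub>c B)) \<circ>\<^sub>m (C @\<^sub>c B) = 0\<^sub>m l (r + s) \<longleftrightarrow>
      W * C = 0\<^sub>m l r \<and> (W * B) \<circ>\<^sub>m B = 0\<^sub>m l s" if W: "W \<in> carrier_mat l l" for W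
  proof -
    have "(W * (C @\<^sub>c B)) \<circ>\<^sub>m (C @\<^sub>c B) = ((W * C) \<circ>\<^sub>m C) @\<^sub>c ((W * B) \<circ>\<^sub>m B)"
      using C B W by (simp add: mult_append_cols hadamard_append_cols[of _ l r _ s])
    moreover have "(W * C) \<circ>\<^sub>m C = 0\<^sub>m l r \<longleftrightarrow> W * C = 0\<^sub>m l r"
      by (rule hadamard_eq_zero_iff[OF _ C nz]) (use C W in auto)
    ultimately show ?thesis
      using C B W by (simp add: append_cols_eq_zero_iff)
  qed
  then show ?thesis
    by (auto simp: mem_SIPP_kernel_iff[OF append_cols_carrier[OF C B]] mem_SIPP_kernel_iff[OF B])
qed

context
  fixes A B C S :: "'a :: semiring_1_no_zero_divisors mat" and k l r s :: nat
  assumes A: "A \<in> carrier_mat k r" and C: "C \<in> carrier_mat l r" and B: "B \<in> carrier_mat l s"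
    and S: "S \<in> carrier_mat r k" and AS: "A * S = 1\<^sub>m k" and CS: "C * S = 0\<^sub>m l k"
    and nz: "0 \<notin> elements_mat C"
begin

lemma four_block_mat_mem_SIPP_kernel_iff:
  assumes Y: "Y \<in> carrier_mat k k" and Z: "Z \<in> carrier_mat k l" and W: "W \<in> carrier_mat l l"
  shows "four_block_mat Y Z Z\<^sup>T W \<in> SIPP_kernel (four_block_mat A (0\<^sub>m k s) C B) \<longleftrightarrow>
    Z = 0\<^sub>m k l \<and> Y \<in> SIPP_kernel A \<and> W \<in> SIPP_kernel (C @\<^sub>c B)"
    (is "?X \<in> SIPP_kernel ?P \<longleftrightarrow> _")
proof -
  have P: "?P \<in> carrier_mat (k + l) (r + s)" and X: "?X \<in> carrier_mat (k + l) (k + l)"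
    using A B Y W by auto
  have "?X * ?P = four_block_mat (Y * A + Z * C) (Z * B) (Z\<^sup>T * A + W * C) (W * B)"
    using A B C Y Z W by (subst mult_four_block_mat[of _ k k _ l _ l _ _ r _ s]) auto
  then have "(?X * ?P) \<circ>\<^sub>m ?P = four_block_mat
      ((Y * A + Z * C) \<circ>\<^sub>m A) (0\<^sub>m k s) ((Z\<^sup>T * A + W * C) \<circ>\<^sub>m C) ((W * B) \<circ>\<^sub>m B)"
    using A B C Y Z W
    by (simp add: hadamard_four_block_mat[of _ k r _ s _ l] hadamard_zero_right[of _ k s])
  then have blocks: "(?X * ?P) \<circ>\<^sub>m ?P = 0\<^sub>m (k + l) (r + s) \<longleftrightarrow> (Y * A + Z * C) \<circ>\<^sub>m A = 0\<^sub>m k r \<and>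
      (Z\<^sup>T * A + W * C) \<circ>\<^sub>m C = 0\<^sub>m l r \<and> (W * B) \<circ>\<^sub>m B = 0\<^sub>m l s"
    using A B C Y Z W by (simp add: four_block_mat_eq_zero_iff)
  have "(Z\<^sup>T * A + W * C) \<circ>\<^sub>m C = 0\<^sub>m l r \<longleftrightarrow> Z\<^sup>T * A + W * C = 0\<^sub>m l r"
    by (rule hadamard_eq_zero_iff[OF _ C nz]) (use A C Z W in auto)
  also have "\<dots> \<longleftrightarrow> Z\<^sup>T = 0\<^sub>m l k \<and> W * C = 0\<^sub>m l r"
    by (rule mult_add_mult_eq_zero_iff[OF A C S AS CS _ W]) (use Z in simp)
  also have "Z\<^sup>T = 0\<^sub>m l k \<longleftrightarrow> Z = 0\<^sub>m k l"
    by (metis transpose_transpose zero_transpose_mat)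
  finally have "(?X * ?P) \<circ>\<^sub>m ?P = 0\<^sub>m (k + l) (r + s) \<longleftrightarrow>
      Z = 0\<^sub>m k l \<and> (Y * A) \<circ>\<^sub>m A = 0\<^sub>m k r \<and> W * C = 0\<^sub>m l r \<and> (W * B) \<circ>\<^sub>m B = 0\<^sub>m l s"
    unfolding blocks using A C Y by auto
  moreover have "?X\<^sup>T = ?X \<longleftrightarrow> Y\<^sup>T = Y \<and> W\<^sup>T = W"
    using Y Z W by (simp add: symmetric_four_block_mat_iff)
  ultimately show ?thesis
    unfolding mem_SIPP_kernel_iff[OF P] mem_SIPP_kernel_iff[OF A] mem_SIPP_kernel_iff[OF B]
      SIPP_kernel_append_cols[OF C B nz] mem_Collect_eq
    using X Y W by blast
qed

lemma SIPP_kernel_four_block_mat: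
  "SIPP_kernel (four_block_mat A (0\<^sub>m k s) C B) =
    {four_block_mat Y (0\<^sub>m k l) (0\<^sub>m l k) W | Y W.
      Y \<in> SIPP_kernel A \<and> W \<in> SIPP_kernel (C @\<^sub>c B)}"
    (is "SIPP_kernel ?P = ?D")
proof (intro equalityI subsetI)
  fix X assume X: "X \<in> SIPP_kernel ?P"
  have P: "?P \<in> carrier_mat (k + l) (r + s)"
    using A B by simp
  have "X \<in> carrier_mat (k + l) (k + l)" "X\<^sup>T = X"
    using X mem_SIPP_kernel_iff[OF P] by blast+
  then obtain Y Z W where blocks: "Y \<in> carrier_mat k k" "Z \<in> carrier_mat k l"
      "W \<in> carrier_mat l l"
    and X_eq: "X = four_block_mat Y Z Z\<^sup>T W"
    by (rule symmetric_mat_blocks)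
  have "Z = 0\<^sub>m k l \<and> Y \<in> SIPP_kernel A \<and> W \<in> SIPP_kernel (C @\<^sub>c B)"
    using X unfolding X_eq four_block_mat_mem_SIPP_kernel_iff[OF blocks] .
  then show "X \<in> ?D"
    unfolding X_eq by auto
next
  fix X assume "X \<in> ?D"
  then obtain Y W where YW: "Y \<in> SIPP_kernel A" "W \<in> SIPP_kernel (C @\<^sub>c B)"
    and X_eq: "X = four_block_mat Y (0\<^sub>m k l) (0\<^sub>m k l)\<^sup>T W"
    by auto
  then have carriers: "Y \<in> carrier_mat k k" "W \<in> carrier_mat l l"
    using mem_SIPP_kernel_iff[OF A] mem_SIPP_kernel_iff[OF append_cols_carrier[OF C B]] by blast+
  show "X \<in> SIPP_kernel ?P"
    unfolding X_eq four_block_mat_mem_SIPP_kernel_iff[OF carriers(1) zero_carrier_mat carriers(2)]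
    using YW by simp
qed

lemma SIPP_kernel_four_block_mat_trivial_iff:
  "SIPP_kernel (four_block_mat A (0\<^sub>m k s) C B) = {0\<^sub>m (k + l) (k + l)} \<longleftrightarrow>
    SIPP_kernel A = {0\<^sub>m k k} \<and> SIPP_kernel (C @\<^sub>c B) = {0\<^sub>m l l}"
    (is "SIPP_kernel ?P = _ \<longleftrightarrow> ?trivial")
proof
  note CB = append_cols_carrier[OF C B]
  assume P: "SIPP_kernel ?P = {0\<^sub>m (k + l) (k + l)}"
  have "Y = 0\<^sub>m k k \<and> W = 0\<^sub>m l l"
    if YW: "Y \<in> SIPP_kernel A" "W \<in> SIPP_kernel (C @\<^sub>c B)" for Y W
  proof -
    have "four_block_mat Y (0\<^sub>m k l) (0\<^sub>m l k) W = 0\<^sub>m (k + l) (k + l)"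
      using YW P unfolding SIPP_kernel_four_block_mat by blast
    moreover have "Y \<in> carrier_mat k k" "W \<in> carrier_mat l l"
      using YW mem_SIPP_kernel_iff[OF A] mem_SIPP_kernel_iff[OF CB] by blast+
    ultimately show ?thesis
      by (simp add: four_block_mat_eq_zero_iff)
  qed
  then show ?trivial
    using zero_mem_SIPP_kernel[OF A] zero_mem_SIPP_kernel[OF CB] by blast
next
  assume ?trivial
  then show "SIPP_kernel ?P = {0\<^sub>m (k + l) (k + l)}"
    unfolding SIPP_kernel_four_block_mat by simp
qed

end

lemma SIPP_kernel_append_rows_trivial_iff:
  fixes A :: "'a :: semiring_1_no_zero_divisors mat"
  assumes A: "A \<in> carrier_mat k r" and R: "R \<in> carrier_mat m r"
    and S: "S \<in> carrier_mat r k" and AS: "A * S = 1\<^sub>m k" and RS: "R * S = 0\<^sub>m m k"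
    and T: "T \<in> carrier_mat r m" and RT: "R * T = 1\<^sub>m m"
    and nz: "0 \<notin> elements_mat R"
  shows "SIPP_kernel (A @\<^sub>r R) = {0\<^sub>m (k + m) (k + m)} \<longleftrightarrow> SIPP_kernel A = {0\<^sub>m k k}"
proof -
  have "SIPP_kernel R = {0\<^sub>m m m}"
    using mult_eq_zero_iff_of_right_inverse[OF _ R T RT, of _ m] R
    by (auto simp: SIPP_kernel_nowhere_zero[OF R nz])
  then show ?thesis
    using SIPP_kernel_four_block_mat_trivial_iff[OF A R zero_carrier_mat S AS RS nz, of 0]
    by (simp add: append_rows_eq_four_block_mat[OF A R] append_cols_no_cols[OF R])
qed

lemma SIPP_kernel_mult_append_cols:
  fixes L :: "'a :: semiring_1_no_zero_divisors mat"
  assumes L: "L \<in> carrier_mat l m" and R: "R \<in> carrier_mat m r" and B: "B \<in> carrier_mat l s"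
    and T: "T \<in> carrier_mat r m" and RT: "R * T = 1\<^sub>m m"
    and nz: "0 \<notin> elements_mat L" "0 \<notin> elements_mat (L * R)"
  shows "SIPP_kernel (L * R @\<^sub>c B) = SIPP_kernel (L @\<^sub>c B)"
proof -
  have "W * (L * R) = 0\<^sub>m l r \<longleftrightarrow> W * L = 0\<^sub>m l m" if "W \<in> SIPP_kernel B" for W
  proof -
    have W: "W \<in> carrier_mat l l"
      using that mem_SIPP_kernel_iff[OF B] by blast
    show ?thesis
      unfolding assoc_mult_mat[OF W L R, symmetric]
      by (rule mult_eq_zero_iff_of_right_inverse[OF mult_carrier_mat[OF W L] R T RT])
  qed
  then show ?thesis
    using SIPP_kernel_append_cols[OF mult_carrier_mat[OF L R] B nz(2)]
      SIPP_kernel_append_cols[OF L B nz(1)] by auto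
qed

subsection \<open>Row orthogonal matrices\<close>

lemma row_orthogonal_append_cols_iff:
  assumes "C \<in> carrier_mat l r" "B \<in> carrier_mat l s"
  shows "row_orthogonal (C @\<^sub>c B) \<longleftrightarrow> C * C\<^sup>T + B * B\<^sup>T = 1\<^sub>m l"
  using carrier_matD(1)[OF append_cols_carrier[OF assms]]
  by (simp add: row_orthogonal_def append_cols_mult_transpose[OF assms])

lemma row_orthogonal_four_block_mat_iff:
  assumes A: "A \<in> carrier_mat k r" and C: "C \<in> carrier_mat l r" and B: "B \<in> carrier_mat l s"
  shows "row_orthogonal (four_block_mat A (0\<^sub>m k s) C B) \<longleftrightarrow>
    row_orthogonal A \<and> C * A\<^sup>T = 0\<^sub>m l k \<and> row_orthogonal (C @\<^sub>c B)"
proof -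
  let ?P = "four_block_mat A (0\<^sub>m k s) C B"
  have "?P * ?P\<^sup>T = four_block_mat (A * A\<^sup>T) (A * C\<^sup>T) (C * A\<^sup>T) (C * C\<^sup>T + B * B\<^sup>T)"
    using A B C
    by (simp add: transpose_four_block_mat[of _ k r _ s _ l]
        mult_four_block_mat[of _ k r _ s _ l _ _ k _ l])
  moreover have "\<dots> = 1\<^sub>m (k + l) \<longleftrightarrow> A * A\<^sup>T = 1\<^sub>m k \<and> A * C\<^sup>T = 0\<^sub>m k l \<and>
      C * A\<^sup>T = 0\<^sub>m l k \<and> C * C\<^sup>T + B * B\<^sup>T = 1\<^sub>m l"
    unfolding four_block_one_mat[symmetric]
    by (rule four_block_mat_eq_iff) (use A B C in auto)
  moreover have "A * C\<^sup>T = (C * A\<^sup>T)\<^sup>T"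
    using A C by (simp add: transpose_mult[of _ _ r])
  ultimately show ?thesis
    using A B by (auto simp: row_orthogonal_def[of A] row_orthogonal_def[of ?P]
        row_orthogonal_append_cols_iff[OF C B])
qed

lemma row_orthogonal_append_rows_iff:
  assumes A: "A \<in> carrier_mat k r" and R: "R \<in> carrier_mat m r"
  shows "row_orthogonal (A @\<^sub>r R) \<longleftrightarrow> row_orthogonal A \<and> R * A\<^sup>T = 0\<^sub>m m k \<and> row_orthogonal R"
  using row_orthogonal_four_block_mat_iff[OF A R zero_carrier_mat, of 0]
  by (simp add: append_rows_eq_four_block_mat[OF A R] append_cols_no_cols[OF R])

lemma rank_eq_of_right_inverse:
  fixes P :: "'a :: field mat"
  assumes P: "P \<in> carrier_mat n q" and S: "S \<in> carrier_mat q n" and PS: "P * S = 1\<^sub>m n"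
  shows "vec_space.rank n P = n"
proof -
  interpret vec_space "TYPE('a)" n .
  have "\<exists>x \<in> carrier_vec q. P *\<^sub>v x = y" if y: "y \<in> carrier_vec n" for y
  proof
    show "P *\<^sub>v (S *\<^sub>v y) = y"
      using assoc_mult_mat_vec[OF P S y] PS y by simp
    show "S *\<^sub>v y \<in> carrier_vec q"
      using S y by (rule mult_mat_vec_carrier)
  qed
  then have "span (set (cols P)) = carrier_vec n"
    using col_space_eq[OF P] P unfolding col_space_def by auto
  then have "rank P = vectorspace.dim class_ring (vs (carrier_vec n))"
    unfolding rank_def by simp
  also have "vs (carrier_vec n) = V"
    by (simp add: module_vec_def)
  finally show ?thesis
    unfolding dim_is_n .
qed

lemma SIPP_row_orthogonal_iff:
  assumes orth: "row_orthogonal P" and P: "P \<in> carrier_mat m n"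
  shows "SIPP P \<longleftrightarrow> SIPP_kernel P = {0\<^sub>m m m}"
proof -
  have rank: "vec_space.rank m P = m"
    using rank_eq_of_right_inverse[OF P, of "P\<^sup>T"] orth P by (simp add: row_orthogonal_def)
  then have "m \<le> n"
    using vec_space.rank_le_nc[OF P] by simp
  with rank have "SIPP P \<longleftrightarrow> SIPP_kernel P \<subseteq> {0\<^sub>m m m}"
    using P by (auto simp: SIPP_def SIPP_kernel_def)
  then show ?thesis
    using zero_mem_SIPP_kernel[OF P] by blast
qed

subsection \<open>Gluing row orthogonal matrices\<close>

lemma row_orthogonal_glue:
  assumes A: "A \<in> carrier_mat k r" and R: "R \<in> carrier_mat m r"
    and L: "L \<in> carrier_mat l m" and B: "B \<in> carrier_mat l s"
    and orth: "row_orthogonal (A @\<^sub>r R)" "row_orthogonal (L @\<^sub>c B)"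
  shows "row_orthogonal (four_block_mat A (0\<^sub>m k s) (L * R) B)"
proof -
  have A_orth: "row_orthogonal A" and RA: "R * A\<^sup>T = 0\<^sub>m m k" and RR: "R * R\<^sup>T = 1\<^sub>m m"
    using orth(1) R by (auto simp: row_orthogonal_append_rows_iff[OF A R] row_orthogonal_def[of R])
  have LR: "L * R \<in> carrier_mat l r"
    using L R by simp
  have "L * R * (L * R)\<^sup>T = L * R * (R\<^sup>T * L\<^sup>T)"
    using L R by (simp add: transpose_mult)
  also have "\<dots> = L * (R * R\<^sup>T * L\<^sup>T)"
    using L R by (simp add: assoc_mult_mat[of _ l m _ r _ l] assoc_mult_mat[of _ m r _ m _ l])
  finally have "L * R * (L * R)\<^sup>T = L * L\<^sup>T"
    using L by (simp add: RR)
  then have "row_orthogonal (L * R @\<^sub>c B)"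
    using orth(2) by (simp add: row_orthogonal_append_cols_iff[OF LR B]
        row_orthogonal_append_cols_iff[OF L B])
  moreover have "L * R * A\<^sup>T = 0\<^sub>m l k"
    using A L R by (simp add: RA)
  ultimately show ?thesis
    using A_orth by (simp add: row_orthogonal_four_block_mat_iff[OF A LR B])
qed

lemma SIPP_glue_iff:
  assumes A: "A \<in> carrier_mat k r" and R: "R \<in> carrier_mat m r"
    and L: "L \<in> carrier_mat l m" and B: "B \<in> carrier_mat l s"
    and orth: "row_orthogonal (A @\<^sub>r R)" "row_orthogonal (L @\<^sub>c B)"
    and nz: "0 \<notin> elements_mat R" "0 \<notin> elements_mat L" "0 \<notin> elements_mat (L * R)"
  shows "SIPP (four_block_mat A (0\<^sub>m k s) (L * R) B) \<longleftrightarrow> SIPP (A @\<^sub>r R) \<and> SIPP (L @\<^sub>c B)"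
    (is "SIPP ?Q \<longleftrightarrow> _")
proof -
  have AA: "A * A\<^sup>T = 1\<^sub>m k" and RA: "R * A\<^sup>T = 0\<^sub>m m k" and RR: "R * R\<^sup>T = 1\<^sub>m m"
    using orth(1) A R by (auto simp: row_orthogonal_append_rows_iff[OF A R]
        row_orthogonal_def[of A] row_orthogonal_def[of R])
  have AT: "A\<^sup>T \<in> carrier_mat r k" and RT: "R\<^sup>T \<in> carrier_mat r m"
    and LR: "L * R \<in> carrier_mat l r" and LRA: "L * R * A\<^sup>T = 0\<^sub>m l k"
    using A L R by (auto simp: RA)
  have Q: "?Q \<in> carrier_mat (k + l) (r + s)"
    using A B by simp
  have "SIPP ?Q \<longleftrightarrow> SIPP_kernel ?Q = {0\<^sub>m (k + l) (k + l)}"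
    by (rule SIPP_row_orthogonal_iff[OF row_orthogonal_glue[OF A R L B orth] Q])
  also have "\<dots> \<longleftrightarrow> SIPP_kernel A = {0\<^sub>m k k} \<and> SIPP_kernel (L * R @\<^sub>c B) = {0\<^sub>m l l}"
    by (rule SIPP_kernel_four_block_mat_trivial_iff[OF A LR B AT AA LRA nz(3)])
  also have "SIPP_kernel (L * R @\<^sub>c B) = SIPP_kernel (L @\<^sub>c B)"
    by (rule SIPP_kernel_mult_append_cols[OF L R B RT RR nz(2,3)])
  also have "SIPP_kernel (L @\<^sub>c B) = {0\<^sub>m l l} \<longleftrightarrow> SIPP (L @\<^sub>c B)"
    by (rule SIPP_row_orthogonal_iff[OF orth(2) append_cols_carrier[OF L B], symmetric])
  also have "SIPP_kernel A = {0\<^sub>m k k} \<longleftrightarrow> SIPP_kernel (A @\<^sub>r R) = {0\<^sub>m (k + m) (k + m)}"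
    by (rule SIPP_kernel_append_rows_trivial_iff[OF A R AT AA RA RT RR nz(1), symmetric])
  also have "\<dots> \<longleftrightarrow> SIPP (A @\<^sub>r R)"
    by (rule SIPP_row_orthogonal_iff[OF orth(1) carrier_append_rows[OF A R], symmetric])
  finally show ?thesis .
qed

lemma mat_of_col_carrier: "v \<in> carrier_vec n \<Longrightarrow> mat_of_col v \<in> carrier_mat n 1"
  unfolding mat_of_col_def by auto

lemma mat_of_col_mult_mat_of_row_index:
  fixes u v :: "'a :: semiring_0 vec"
  assumes "i < dim_vec u" "j < dim_vec v"
  shows "(mat_of_col u * mat_of_row v) $$ (i, j) = u $ i * v $ j"
  using assms by (simp add: mat_of_col_def mat_of_cols_index scalar_prod_def)

lemma zero_notin_elements_mat_of_row:
  "nowhere_zero v \<Longrightarrow> 0 \<notin> elements_mat (mat_of_row v)"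
  by (auto simp: nowhere_zero_def)

lemma zero_notin_elements_mat_of_col:
  "nowhere_zero v \<Longrightarrow> 0 \<notin> elements_mat (mat_of_col v)"
  by (auto simp: nowhere_zero_def mat_of_col_def mat_of_cols_index)

lemma zero_notin_elements_mat_of_col_mult_mat_of_row:
  fixes u v :: "'a :: semiring_no_zero_divisors vec"
  assumes "nowhere_zero u" "nowhere_zero v"
  shows "0 \<notin> elements_mat (mat_of_col u * mat_of_row v)"
proof
  assume "0 \<in> elements_mat (mat_of_col u * mat_of_row v)"
  then obtain i j where "i < dim_vec u" "j < dim_vec v"
    and "(mat_of_col u * mat_of_row v) $$ (i, j) = 0"
    by (auto dest!: elements_matD simp: mat_of_col_def)
  then show False
    using assms by (auto simp: mat_of_col_mult_mat_of_row_index nowhere_zero_def)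
qed

theorem proposition5p6:
  fixes A B M N Q :: "real mat" and a b :: "real vec" and k r l s :: nat
  assumes "A \<in> carrier_mat k r" and "a \<in> carrier_vec r"
    and "b \<in> carrier_vec l" and "B \<in> carrier_mat l s"
    and "M = A @\<^sub>r mat_of_row a"
    and "N = mat_of_col b @\<^sub>c B"
    and "row_orthogonal M" and "row_orthogonal N"
    and "nowhere_zero a" and "nowhere_zero b"
    and "Q = four_block_mat A (0\<^sub>m k s) (mat_of_col b * mat_of_row a) B"
  shows "row_orthogonal Q \<and> (SIPP Q \<longleftrightarrow> SIPP M \<and> SIPP N)"
proof -
  note carriers = \<open>A \<in> carrier_mat k r\<close> mat_of_row_carrier(1)[OF \<open>a \<in> carrier_vec r\<close>]
    mat_of_col_carrier[OF \<open>b \<in> carrier_vec l\<close>] \<open>B \<in> carrier_mat l s\<close>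
  have orth: "row_orthogonal (A @\<^sub>r mat_of_row a)" "row_orthogonal (mat_of_col b @\<^sub>c B)"
    using assms by simp_all
  have "row_orthogonal Q"
    unfolding \<open>Q = _\<close> by (rule row_orthogonal_glue[OF carriers orth])
  moreover have "SIPP Q \<longleftrightarrow> SIPP M \<and> SIPP N"
    unfolding \<open>Q = _\<close> \<open>M = _\<close> \<open>N = _\<close> using \<open>nowhere_zero a\<close> \<open>nowhere_zero b\<close>
    by (intro SIPP_glue_iff[OF carriers orth] zero_notin_elements_mat_of_row
        zero_notin_elements_mat_of_col zero_notin_elements_mat_of_col_mult_mat_of_row)
  ultimately show ?thesis ..
qed

end
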